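(* Let $a\in\mathbb{R}$ with $a\ne 0$, let $T>0$, and let $$\Phi_T=\begin{pmatrix}0&1&0\\ 0&a&1\\ -\dfrac{a^2}{e^{aT}-1-aT} & -\dfrac{a(e^{aT}-1)}{e^{aT}-1-aT} & -1\end{pmatrix}.$$ Then $\Phi_T$ is Hurwitz if and only if the following two conditions are satisfied: (i) $a<1$, and (ii) $T>\dfrac{1}{1-a}$.
   Context: A real square matrix is Hurwitz if all of its eigenvalues have strictly negative real part. *)

theory Defs
  imports "Jordan_Normal_Form.Char_Poly"
begin

(* The eigenvalues of a real matrix are taken over the complex numbers. *)
definition hurwitz :: "real mat \<Rightarrow> bool" where
  "hurwitz A \<longleftrightarrow> square_mat A \<and>
     (\<forall>z. eigenvalue (map_mat complex_of_real A) z \<longrightarrow> Re z < 0)"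

definition Phi :: "real \<Rightarrow> real \<Rightarrow> real mat" where
  "Phi a T = mat_of_rows_list 3
     [[0, 1, 0],
      [0, a, 1],
      [- (a\<^sup>2 / (exp (a * T) - 1 - a * T)),
       - (a * (exp (a * T) - 1) / (exp (a * T) - 1 - a * T)),
       - 1]]"

end

theory Submission
  imports Defs
begin

text \<open>
  Put \<open>p = a\<^sup>2 / (exp (a * T) - 1 - a * T)\<close>, which is positive because \<open>exp x > 1 + x\<close> for
  \<open>x \<noteq> 0\<close>. The entries of \<open>Phi a T\<close> are tuned so that its characteristic polynomial
  collapses to \<open>z\<^sup>2 (z + b) + p (T z + 1)\<close> with \<open>b = 1 - a\<close>, and the theorem says that this cubic
  has all its roots in the open left half plane exactly if \<open>b T > 1\<close> (for \<open>T > 0\<close> this contains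
  the condition \<open>b > 0\<close>). This is the Routh--Hurwitz criterion for the cubic, but both directions
  have a short direct proof.

  If \<open>b T > 1\<close>, write a root as \<open>z\<^sup>2 = - p (T z + 1) / (z + b)\<close>. Suppose
  \<open>Re z \<ge> 0\<close>. Then the right-hand side has negative real part, so \<open>z\<close> is not real; but the
  imaginary part of the right-hand side has the sign opposite to \<open>Im z\<close>, whereas that of
  \<open>z\<^sup>2\<close>, namely \<open>2 Re z Im z\<close>, does not (\<open>cubic_root_Re_neg\<close>).

  If \<open>b T \<le> 1\<close>, the cubic has the nonnegative value \<open>p (1 - b T)\<close> at \<open>- b\<close>, hence a real root
  \<open>r \<le> - b\<close>. The roots sum to \<open>- b\<close>, so the other two have sum \<open>- b - r \<ge> 0\<close> and one of them has
  nonnegative real part (\<open>cubic_root_Re_nonneg\<close>).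
\<close>

lemma exp_minus_one_minus_pos:
  fixes x :: real
  assumes "x \<noteq> 0"
  shows "exp x - 1 - x > 0"
  using exp_minus_greater[of "- x"] assms by simp

text \<open>
  The first two rows of the eigenvector equation force \<open>v = v\<^sub>0 (1, z, z (z - a))\<close>, so the third row
  is the characteristic equation, without any determinant.
\<close>

lemma eigenvalue_Phi_iff:
  fixes a T :: real and z :: complex
  assumes "a \<noteq> 0" and "T > 0"
  defines "p \<equiv> a\<^sup>2 / (exp (a * T) - 1 - a * T)"
  shows "eigenvalue (map_mat complex_of_real (Phi a T)) z \<longleftrightarrow>
    z\<^sup>2 * (z + of_real (1 - a)) + of_real p * (of_real T * z + 1) = 0"
proof -
  define D where "D = exp (a * T) - 1 - a * T"
  define q where "q = a * (exp (a * T) - 1) / D"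
  define A where "A = map_mat complex_of_real (Phi a T)"
  have D: "D \<noteq> 0"
    using exp_minus_one_minus_pos[of "a * T"] assms by (simp add: D_def)
  \<comment> \<open>The exponential cancels from \<open>q - a\<close>, the linear coefficient of the characteristic polynomial.\<close>
  have q: "q = a + p * T"
    using D by (simp add: q_def p_def D_def[symmetric] divide_simps)
      (simp add: D_def algebra_simps power2_eq_square)
  have dims: "dim_row A = 3" "dim_col A = 3"
    by (simp_all add: A_def Phi_def mat_of_rows_list_def)
  have entries: "A $$ (0, 0) = 0" "A $$ (0, 1) = 1" "A $$ (0, 2) = 0"
    "A $$ (1, 0) = 0" "A $$ (1, 1) = of_real a" "A $$ (1, 2) = 1"
    "A $$ (2, 0) = - of_real p" "A $$ (2, 1) = - of_real q" "A $$ (2, 2) = - 1"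
    by (simp_all add: A_def Phi_def mat_of_rows_list_def p_def q_def D_def)
  have index_mult: "(A *\<^sub>v v) $ i = A $$ (i, 0) * v $ 0 + A $$ (i, 1) * v $ 1 + A $$ (i, 2) * v $ 2"
    if "v \<in> carrier_vec 3" "i < 3" for v i
  proof -
    have "(A *\<^sub>v v) $ i = (\<Sum>j\<in>{0..<3}. A $$ (i, j) * v $ j)"
      using that dims by (simp add: scalar_prod_def)
    also have "{0..<3} = {0, 1, 2 :: nat}"
      by auto
    finally show ?thesis
      by simp
  qed
  have vec3_eq_iff: "v = w \<longleftrightarrow> v $ 0 = w $ 0 \<and> v $ 1 = w $ 1 \<and> v $ 2 = w $ 2"
    if "dim_vec v = 3" "dim_vec w = 3" for v w :: "complex vec"
  proof -
    have "i < 3 \<longleftrightarrow> i = 0 \<or> i = 1 \<or> i = 2" for i :: nat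
      by auto
    then show ?thesis
      using that by (auto simp: vec_eq_iff)
  qed
  have eq: "A *\<^sub>v v = z \<cdot>\<^sub>v v \<longleftrightarrow>
      v $ 1 = z * v $ 0 \<and> of_real a * v $ 1 + v $ 2 = z * v $ 1 \<and>
      - of_real p * v $ 0 - of_real q * v $ 1 - v $ 2 = z * v $ 2"
    if v: "v \<in> carrier_vec 3" for v
  proof -
    have "A *\<^sub>v v = z \<cdot>\<^sub>v v \<longleftrightarrow>
        (A *\<^sub>v v) $ 0 = z * v $ 0 \<and> (A *\<^sub>v v) $ 1 = z * v $ 1 \<and> (A *\<^sub>v v) $ 2 = z * v $ 2"
      using v dims by (subst vec3_eq_iff) auto
    then show ?thesis
      using v by (simp only: index_mult entries) simp
  qed
  have char: "- of_real p - of_real q * z - (z\<^sup>2 - of_real a * z) = z * (z\<^sup>2 - of_real a * z) \<longleftrightarrow>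
      z\<^sup>2 * (z + of_real (1 - a)) + of_real p * (of_real T * z + 1) = 0"
    by (auto simp: q power2_eq_square algebra_simps)
  have "eigenvalue A z \<longleftrightarrow> (\<exists>v \<in> carrier_vec 3. v \<noteq> 0\<^sub>v 3 \<and> A *\<^sub>v v = z \<cdot>\<^sub>v v)"
    by (auto simp: eigenvalue_def eigenvector_def dims)
  also have "\<dots> \<longleftrightarrow> - of_real p - of_real q * z - (z\<^sup>2 - of_real a * z) = z * (z\<^sup>2 - of_real a * z)"
    (is "?L \<longleftrightarrow> ?R")
  proof
    assume ?L
    then obtain v where v: "v \<in> carrier_vec 3" "v \<noteq> 0\<^sub>v 3" and "A *\<^sub>v v = z \<cdot>\<^sub>v v"
      by blast
    with eq have v1: "v $ 1 = z * v $ 0" and v2: "v $ 2 = (z\<^sup>2 - of_real a * z) * v $ 0"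
      and last: "- of_real p * v $ 0 - of_real q * v $ 1 - v $ 2 = z * v $ 2"
      by (auto simp: algebra_simps power2_eq_square)
    have "v $ 0 \<noteq> 0"
    proof
      assume "v $ 0 = 0"
      with v1 v2 v(1) have "v = 0\<^sub>v 3"
        by (simp add: vec3_eq_iff)
      with v(2) show False ..
    qed
    moreover have "(- of_real p - of_real q * z - (z\<^sup>2 - of_real a * z)) * v $ 0 =
        z * (z\<^sup>2 - of_real a * z) * v $ 0"
      using last unfolding v1 v2 by (simp add: algebra_simps)
    ultimately show ?R
      by simp
  next
    assume ?R
    define v where "v = vec 3 (\<lambda>i. [1, z, z\<^sup>2 - of_real a * z] ! i)"
    have v: "v \<in> carrier_vec 3" "v $ 0 = 1" "v $ 1 = z" "v $ 2 = z\<^sup>2 - of_real a * z"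
      by (simp_all add: v_def)
    moreover have "v \<noteq> 0\<^sub>v 3"
      using v(2) by auto
    moreover have "A *\<^sub>v v = z \<cdot>\<^sub>v v"
      using \<open>?R\<close> unfolding eq[OF v(1)] v by (simp add: power2_eq_square)
    ultimately show ?L
      by blast
  qed
  also note char
  finally show ?thesis
    by (simp only: A_def)
qed

text \<open>
  Multiplying the equation by \<open>cnj z + b\<close> makes the coefficient of \<open>z\<^sup>2\<close> a nonnegative real number,
  so that real and imaginary parts can be compared.
\<close>

lemma cubic_root_Re_neg:
  fixes b p T :: real and z :: complex
  assumes "p > 0" and "T > 0" and "b * T > 1"
    and root: "z\<^sup>2 * (z + of_real b) + of_real p * (of_real T * z + 1) = 0"
  shows "Re z < 0"
proof (rule ccontr)
  assume "\<not> Re z < 0"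
  define x y where "x = Re z" and "y = Im z"
  have x: "x \<ge> 0" and b: "b > 0"
    using \<open>\<not> Re z < 0\<close> assms(2,3) zero_less_mult_pos2[of b T] by (simp_all add: x_def)
  have z: "z = Complex x y"
    by (simp add: x_def y_def)
  define N where "N = (x + b)\<^sup>2 + y\<^sup>2"
  have N: "N > 0"
    using x b by (simp add: N_def add_pos_nonneg)
  have "(z\<^sup>2 * (z + of_real b) + of_real p * (of_real T * z + 1)) * (cnj z + of_real b) = 0"
    using root by simp
  also have "(z\<^sup>2 * (z + of_real b) + of_real p * (of_real T * z + 1)) * (cnj z + of_real b) =
    Complex ((x\<^sup>2 - y\<^sup>2) * N + p * (T * (x\<^sup>2 + y\<^sup>2) + b + (b * T + 1) * x))
      (y * (2 * x * N + p * (b * T - 1)))"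
    by (simp add: z N_def complex_eq_iff power2_eq_square algebra_simps)
  finally have re: "(x\<^sup>2 - y\<^sup>2) * N + p * (T * (x\<^sup>2 + y\<^sup>2) + b + (b * T + 1) * x) = 0"
    and im: "y * (2 * x * N + p * (b * T - 1)) = 0"
    by (simp_all add: complex_eq_iff)
  have "2 * x * N + p * (b * T - 1) > 0"
    using x N assms by (intro add_nonneg_pos) auto
  with im have "y = 0"
    by simp
  moreover have "(b * T + 1) * x \<ge> 0"
    using x assms(3) by (intro mult_nonneg_nonneg) auto
  then have "p * (T * (x\<^sup>2 + y\<^sup>2) + b + (b * T + 1) * x) > 0"
    using b assms(1,2) by (intro mult_pos_pos add_pos_nonneg add_nonneg_pos) auto
  moreover have "x\<^sup>2 * N \<ge> 0"
    using N by simp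
  ultimately show False
    using re by simp
qed

lemma quadratic_root_Re_nonneg:
  fixes s t :: real
  assumes "s \<le> 0"
  obtains z :: complex where "z\<^sup>2 + of_real s * z + of_real t = 0" and "Re z \<ge> 0"
proof
  let ?w = "csqrt (of_real (s\<^sup>2 - 4 * t))"
  let ?z = "(?w - of_real s) / 2"
  have "?z\<^sup>2 + of_real s * ?z + of_real t = (?w\<^sup>2 - of_real (s\<^sup>2 - 4 * t)) / 4"
    by (simp add: power2_eq_square field_simps)
  then show "?z\<^sup>2 + of_real s * ?z + of_real t = 0"
    by simp
  show "Re ?z \<ge> 0"
    using assms Re_csqrt[of "of_real (s\<^sup>2 - 4 * t)"] by (simp del: csqrt.sel)
qed

text \<open>
  Since \<open>b T \<le> 1\<close>, the cubic is nonnegative at \<open>- b\<close>, which is the sum of its roots. So there is a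
  real root \<open>r \<le> - b\<close>, and splitting it off leaves a quadratic whose roots have sum \<open>- b - r \<ge> 0\<close>.
\<close>

lemma cubic_root_Re_nonneg:
  fixes b p T :: real
  assumes "p > 0" and "T > 0" and "b * T \<le> 1"
  obtains z :: complex
  where "z\<^sup>2 * (z + of_real b) + of_real p * (of_real T * z + 1) = 0" and "Re z \<ge> 0"
proof -
  define f where "f x = x\<^sup>2 * (x + b) + p * (T * x + 1)" for x
  \<comment> \<open>At \<open>- M\<close> the cubic term alone outweighs \<open>p\<close>: \<open>M \<ge> 1\<close> and \<open>M - b \<ge> 1 + p\<close>.\<close>
  define M where "M = \<bar>b\<bar> + 1 + p"
  have M: "M \<ge> 1" "M - b \<ge> 1 + p"
    using assms(1) by (auto simp: M_def)
  have "M\<^sup>2 * (M - b) \<ge> 1 * (1 + p)"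
    using M assms(1) by (intro mult_mono) auto
  moreover have "p * (T * M) \<ge> 0"
    using M assms by simp
  moreover have "f (- M) = p - M\<^sup>2 * (M - b) - p * (T * M)"
    by (simp add: f_def algebra_simps)
  ultimately have "f (- M) \<le> 0"
    by (simp only: mult_1)
  moreover have "f (- b) \<ge> 0"
    using assms by (simp add: f_def mult.commute)
  moreover have "- M \<le> - b"
    using M assms(1) by simp
  moreover have "continuous_on {- M..- b} f"
    unfolding f_def by (intro continuous_intros)
  ultimately obtain r where r: "r \<le> - b" "f r = 0"
    using IVT'[of f "- M" 0 "- b"] by auto
  define s t where "s = b + r" and "t = p * T + r * s"
  obtain z :: complex where z: "z\<^sup>2 + of_real s * z + of_real t = 0" "Re z \<ge> 0"
    using quadratic_root_Re_nonneg[of s t] r by (auto simp: s_def)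
  have "z\<^sup>2 * (z + of_real b) + of_real p * (of_real T * z + 1) =
      (z - of_real r) * (z\<^sup>2 + of_real s * z + of_real t) + of_real (f r)"
    by (simp add: s_def t_def f_def power2_eq_square algebra_simps)
  with z r show thesis
    by (intro that) auto
qed

theorem proposition2:
  fixes a T :: real
  assumes "a \<noteq> 0" and "T > 0"
  shows "hurwitz (Phi a T) \<longleftrightarrow> a < 1 \<and> T > 1 / (1 - a)"
proof -
  define p where "p = a\<^sup>2 / (exp (a * T) - 1 - a * T)"
  have p: "p > 0"
    using exp_minus_one_minus_pos[of "a * T"] assms by (simp add: p_def)
  have "square_mat (Phi a T)"
    by (simp add: Phi_def mat_of_rows_list_def)
  then have "hurwitz (Phi a T) \<longleftrightarrow>
      (\<forall>z. z\<^sup>2 * (z + of_real (1 - a)) + of_real p * (of_real T * z + 1) = 0 \<longrightarrow> Re z < 0)"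
    unfolding hurwitz_def p_def by (simp only: eigenvalue_Phi_iff[OF assms] simp_thms)
  also have "\<dots> \<longleftrightarrow> (1 - a) * T > 1"
  proof
    assume stable: "\<forall>z. z\<^sup>2 * (z + of_real (1 - a)) + of_real p * (of_real T * z + 1) = 0 \<longrightarrow> Re z < 0"
    show "(1 - a) * T > 1"
    proof (rule ccontr)
      assume "\<not> (1 - a) * T > 1"
      then have "(1 - a) * T \<le> 1"
        by (rule leI)
      then obtain z :: complex
        where "z\<^sup>2 * (z + of_real (1 - a)) + of_real p * (of_real T * z + 1) = 0" and "Re z \<ge> 0"
        by (rule cubic_root_Re_nonneg[OF p assms(2)])
      with stable show False
        by (meson not_le)
    qed
  qed (use cubic_root_Re_neg[OF p assms(2)] in blast)
  also have "\<dots> \<longleftrightarrow> a < 1 \<and> T > 1 / (1 - a)"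
  proof (cases "a < 1")
    case True
    then show ?thesis
      by (simp add: field_simps)
  next
    case False
    then have "(1 - a) * T \<le> 0"
      using assms(2) by (simp add: mult_nonpos_nonneg)
    with False show ?thesis
      by simp
  qed
  finally show ?thesis .
qed

end
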